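(* Let $\epsilon\in\{1,-1\}$. The function $$G(z)=(1+(S_zx,x)_\epsilon)(S_zp,p)_\epsilon-(S_zx,p)_\epsilon^2,\qquad S_z=(zI-A)^{-1},$$ is constant along the geodesic flow $$\frac{dx}{dt}=p,\qquad \frac{dp}{dt}=-\frac{(p,A^{-1}p)_\epsilon}{\|A^{-1}x\|_\epsilon^2}A^{-1}x$$ on the invariant set $(x,A^{-1}x)_\epsilon=1$, $(p,A^{-1}x)_\epsilon=0$, $\|p\|_\epsilon=1$.
   Context: On $\mathbb R^{n+1}$, $(x,y)_\epsilon=x_1y_1+\epsilon\sum_{i=2}^{n+1}x_iy_i$ and $\|x\|_\epsilon^2=(x,x)_\epsilon$. $A$ is an invertible real $(n+1)\times(n+1)$ matrix, symmetric relative to $(\cdot,\cdot)_\epsilon$ (i.e. $(Ax,y)_\epsilon=(x,Ay)_\epsilon$), with $(Au,u)_\epsilon>0$ for all $u\ne0$. It is assumed that $\|A^{-1}x\|_\epsilon\neq0$ along the solutions considered. Here $z$ is any number that is not an eigenvalue of $A$. For $\epsilon=1$ the system describes the geodesics on the ellipsoid $(x,A^{-1}x)=1$. *)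

theory Defs
  imports "HOL-Analysis.Analysis"
begin

text \<open>
  The index \<open>k\<close> marks the distinguished (first) coordinate, and the index type plays the role of
  \<open>{1, ..., n+1}\<close>.  The form is bilinear, not sesquilinear; over the complex numbers it is the
  complex-bilinear extension of the real form.
\<close>

definition eps_form :: "real \<Rightarrow> 'n::finite \<Rightarrow> 'a::real_normed_field ^ 'n \<Rightarrow> 'a ^ 'n \<Rightarrow> 'a" where
  "eps_form \<epsilon> k x y = x $ k * y $ k + \<epsilon> *\<^sub>R (\<Sum>i\<in>UNIV - {k}. x $ i * y $ i)"

text \<open>
  For \<open>\<epsilon> = -1\<close> only the square of the norm is meaningful (it may be negative), so conditions
  such as "norm equal to 1" or "norm nonzero" are stated for the square.
\<close>

definition eps_normsq :: "real \<Rightarrow> 'n::finite \<Rightarrow> real ^ 'n \<Rightarrow> real" where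
  "eps_normsq \<epsilon> k x = eps_form \<epsilon> k x x"

definition eps_symmetric :: "real \<Rightarrow> 'n::finite \<Rightarrow> real ^ 'n ^ 'n \<Rightarrow> bool" where
  "eps_symmetric \<epsilon> k A \<longleftrightarrow> (\<forall>x y. eps_form \<epsilon> k (A *v x) y = eps_form \<epsilon> k x (A *v y))"

definition eps_positive :: "real \<Rightarrow> 'n::finite \<Rightarrow> real ^ 'n ^ 'n \<Rightarrow> bool" where
  "eps_positive \<epsilon> k A \<longleftrightarrow> (\<forall>u. u \<noteq> 0 \<longrightarrow> eps_form \<epsilon> k (A *v u) u > 0)"

text \<open>
  The spectral parameter ranges over a type of class \<^class>\<open>real_normed_field\<close>, so that it may be
  real or complex; real vectors and matrices are embedded entrywise via \<^const>\<open>of_real\<close>, which is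
  the identity on the reals.
\<close>

definition embed_vec :: "real ^ 'n \<Rightarrow> 'a::real_normed_field ^ 'n" where
  "embed_vec x = (\<chi> i. of_real (x $ i))"

definition embed_mat :: "real ^ 'n ^ 'n \<Rightarrow> 'a::real_normed_field ^ 'n ^ 'n" where
  "embed_mat A = map_matrix of_real A"

definition is_eigenvalue :: "'a::field ^ 'n ^ 'n \<Rightarrow> 'a \<Rightarrow> bool" where
  "is_eigenvalue M z \<longleftrightarrow> (\<exists>v. v \<noteq> 0 \<and> M *v v = z *s v)"

definition resolvent :: "real ^ 'n ^ 'n \<Rightarrow> 'a::real_normed_field \<Rightarrow> 'a ^ 'n ^ 'n" where
  "resolvent A z = matrix_inv (mat z - embed_mat A)"

definition geodesic_G ::
    "real \<Rightarrow> 'n::finite \<Rightarrow> real ^ 'n ^ 'n \<Rightarrow> 'a::real_normed_field \<Rightarrow> real ^ 'n \<Rightarrow> real ^ 'n \<Rightarrow> 'a" where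
  "geodesic_G \<epsilon> k A z x p =
     (1 + eps_form \<epsilon> k (resolvent A z *v embed_vec x) (embed_vec x))
        * eps_form \<epsilon> k (resolvent A z *v embed_vec p) (embed_vec p)
     - (eps_form \<epsilon> k (resolvent A z *v embed_vec x) (embed_vec p))\<^sup>2"

definition geodesic_solution ::
    "real \<Rightarrow> 'n::finite \<Rightarrow> real ^ 'n ^ 'n \<Rightarrow> real set
      \<Rightarrow> (real \<Rightarrow> real ^ 'n) \<Rightarrow> (real \<Rightarrow> real ^ 'n) \<Rightarrow> bool" where
  "geodesic_solution \<epsilon> k A T x p \<longleftrightarrow>
     (\<forall>t\<in>T.
        (x has_vector_derivative p t) (at t within T) \<and>
        (p has_vector_derivative
           - (eps_form \<epsilon> k (p t) (matrix_inv A *v p t) / eps_normsq \<epsilon> k (matrix_inv A *v x t))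
             *\<^sub>R (matrix_inv A *v x t)) (at t within T))"

definition geodesic_set ::
    "real \<Rightarrow> 'n::finite \<Rightarrow> real ^ 'n ^ 'n \<Rightarrow> ((real ^ 'n) \<times> (real ^ 'n)) set" where
  "geodesic_set \<epsilon> k A =
     {(x, p). eps_form \<epsilon> k x (matrix_inv A *v x) = 1 \<and>
              eps_form \<epsilon> k p (matrix_inv A *v x) = 0 \<and>
              eps_normsq \<epsilon> k p = 1}"

end

theory Submission
  imports Defs
begin

text \<open>
  Write \<open>B = A\<^sup>-\<^sup>1\<close>, \<open>a = (S\<^sub>z x, x)\<close>, \<open>b = (S\<^sub>z x, p)\<close>, \<open>d = (S\<^sub>z p, p)\<close> and let the
  acceleration be \<open>- c B x\<close>.  Then \<open>a' = 2 b\<close>, \<open>b' = d - c (S\<^sub>z x, B x)\<close> and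
  \<open>d' = - 2 c (S\<^sub>z p, B x)\<close>.  The resolvent identity \<open>z S\<^sub>z B = B + S\<^sub>z\<close> gives on the invariant set
  \<open>z (S\<^sub>z x, B x) = 1 + a\<close> and \<open>z (S\<^sub>z p, B x) = b\<close>, so for \<open>z \<noteq> 0\<close> everything cancels in
  the derivative of \<open>(1 + a) d - b\<^sup>2\<close>.  For \<open>z = 0\<close> the same identities read \<open>1 + a = 0\<close> and
  \<open>b = 0\<close>, and \<open>G\<close> vanishes.
\<close>

section \<open>Bilinear algebra of the form\<close>

text \<open>Absorbing the distinguished coordinate into a weight leaves one sum over all indices, so
  scaling and interchanging sums need no case distinction.\<close>

lemma eps_form_weighted_sum:
  "eps_form \<epsilon> k x y = (\<Sum>i\<in>UNIV. (if i = k then 1 else \<epsilon>) *\<^sub>R (x $ i * y $ i))"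
proof -
  have "(\<Sum>i\<in>UNIV. (if i = k then 1 else \<epsilon>) *\<^sub>R (x $ i * y $ i))
      = x $ k * y $ k + (\<Sum>i\<in>UNIV - {k}. (if i = k then 1 else \<epsilon>) *\<^sub>R (x $ i * y $ i))"
    by (subst sum.remove[of UNIV k]) auto
  also have "(\<Sum>i\<in>UNIV - {k}. (if i = k then 1 else \<epsilon>) *\<^sub>R (x $ i * y $ i))
      = \<epsilon> *\<^sub>R (\<Sum>i\<in>UNIV - {k}. x $ i * y $ i)"
    unfolding scaleR_sum_right by (rule sum.cong) auto
  finally show ?thesis
    by (simp add: eps_form_def)
qed

lemma eps_form_commute: "eps_form \<epsilon> k x y = eps_form \<epsilon> k y x"
  by (simp add: eps_form_def mult.commute)

lemma eps_form_add_left: "eps_form \<epsilon> k (x + y) u = eps_form \<epsilon> k x u + eps_form \<epsilon> k y u"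
  by (simp add: eps_form_def algebra_simps sum.distrib scaleR_add_right)

lemma eps_form_add_right: "eps_form \<epsilon> k u (x + y) = eps_form \<epsilon> k u x + eps_form \<epsilon> k u y"
  by (simp add: eps_form_commute[of _ _ u] eps_form_add_left)

lemma eps_form_scale_left: "eps_form \<epsilon> k (c *s x) u = c * eps_form \<epsilon> k x u"
  by (simp add: eps_form_weighted_sum sum_distrib_left mult.assoc)

lemma eps_form_scale_right: "eps_form \<epsilon> k u (c *s x) = c * eps_form \<epsilon> k u x"
  by (simp add: eps_form_commute[of _ _ u] eps_form_scale_left)

lemma eps_form_scaleR_left: "eps_form \<epsilon> k (c *\<^sub>R x) u = c *\<^sub>R eps_form \<epsilon> k x u"
  by (simp add: eps_form_weighted_sum scaleR_sum_right mult.commute)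

lemma eps_form_scaleR_right: "eps_form \<epsilon> k u (c *\<^sub>R x) = c *\<^sub>R eps_form \<epsilon> k u x"
  by (simp add: eps_form_commute[of _ _ u] eps_form_scaleR_left)

lemma eps_form_diff_left: "eps_form \<epsilon> k (x - y) u = eps_form \<epsilon> k x u - eps_form \<epsilon> k y u"
  using eps_form_add_left[of \<epsilon> k "x - y" y u] by simp

lemma eps_form_diff_right: "eps_form \<epsilon> k u (x - y) = eps_form \<epsilon> k u x - eps_form \<epsilon> k u y"
  by (simp add: eps_form_commute[of _ _ u] eps_form_diff_left)

section \<open>Extension of scalars from the reals\<close>

lemma eps_form_embed:
  "eps_form \<epsilon> k (embed_vec x) (embed_vec y :: 'a::real_normed_field ^ 'n) = of_real (eps_form \<epsilon> k x y)"
  by (simp add: eps_form_def embed_vec_def scaleR_conv_of_real)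

lemma embed_vec_add: "embed_vec (x + y) = embed_vec x + embed_vec y"
  by (simp add: embed_vec_def vec_eq_iff)

lemma embed_vec_scaleR: "embed_vec (c *\<^sub>R x) = c *\<^sub>R embed_vec x"
  by (simp add: embed_vec_def vec_eq_iff) (simp add: scaleR_conv_of_real)

lemma embed_mat_vec: "embed_mat A *v embed_vec x = embed_vec (A *v x)"
  by (simp add: embed_mat_def embed_vec_def vec_eq_iff matrix_vector_mult_def)

lemma mult_scaleR_vec:
  fixes M :: "'a::real_normed_field ^ 'n ^ 'm"
  shows "M *v (c *\<^sub>R x) = c *\<^sub>R (M *v x)"
  by (simp add: matrix_vector_mult_def vec_eq_iff scaleR_sum_right)

lemma mat_mult_vec:
  fixes v :: "'a::comm_semiring_1 ^ 'n"
  shows "mat c *v v = c *s v"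
  by (simp add: matrix_vector_mult_def mat_def vec_eq_iff if_distrib if_distribR sum.delta' cong: if_cong)

text \<open>Symmetry tested on basis vectors: with J the diagonal matrix of weights, J A is a
  symmetric matrix. Unlike the condition on real vectors, identities between entries transfer to the
  larger field.\<close>

lemma eps_symmetric_entries:
  fixes A :: "real ^ 'n ^ 'n"
  assumes "eps_symmetric \<epsilon> k A"
  shows "(if i = k then 1 else \<epsilon>) * A $ i $ j = (if j = k then 1 else \<epsilon>) * A $ j $ i"
proof -
  have "eps_form \<epsilon> k (A *v axis j 1) (axis i 1) = eps_form \<epsilon> k (axis j 1) (A *v axis i 1)"
    using assms by (simp add: eps_symmetric_def)
  \<comment> \<open>Pairing with a basis vector reads off the weighted coordinate.\<close>
  moreover have "eps_form \<epsilon> k u (axis l 1) = (if l = k then 1 else \<epsilon>) * u $ l" for u :: "real ^ 'n" and l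
  proof -
    have "eps_form \<epsilon> k u (axis l 1) = (\<Sum>i\<in>UNIV. if i = l then (if l = k then 1 else \<epsilon>) * u $ l else 0)"
      unfolding eps_form_weighted_sum by (rule sum.cong) (auto simp: axis_def)
    then show ?thesis by simp
  qed
  ultimately show ?thesis
    unfolding eps_form_commute[of _ _ "axis j 1" "A *v axis i 1"]
    by (simp add: matrix_vector_mult_basis column_def)
qed

text \<open>The hypothesis speaks of real vectors only. It reaches vectors over \<open>'a\<close>
  through the entries of A, followed by an interchange of the two sums.\<close>

lemma eps_symmetric_embed:
  fixes A :: "real ^ 'n ^ 'n" and u v :: "'a::real_normed_field ^ 'n"
  assumes "eps_symmetric \<epsilon> k A"
  shows "eps_form \<epsilon> k (embed_mat A *v u) v = eps_form \<epsilon> k u (embed_mat A *v v)"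
proof -
  let ?w = "\<lambda>i. of_real (if i = k then 1 else \<epsilon>) :: 'a"
  let ?A = "\<lambda>i j. of_real (A $ i $ j) :: 'a"
  have entries: "?w i * ?A i j = ?w j * ?A j i" for i j
    using arg_cong[OF eps_symmetric_entries[OF assms, of i j], of "of_real :: real \<Rightarrow> 'a"]
    by (simp only: of_real_mult)
  have "eps_form \<epsilon> k (embed_mat A *v u) v = (\<Sum>i\<in>UNIV. \<Sum>j\<in>UNIV. (?w i * ?A i j) * u $ j * v $ i)"
    unfolding eps_form_weighted_sum matrix_vector_mult_def embed_mat_def scaleR_conv_of_real
      vec_lambda_beta nth_map_matrix sum_distrib_left sum_distrib_right
    by (intro sum.cong refl) (simp only: ac_simps)
  also have "\<dots> = (\<Sum>i\<in>UNIV. \<Sum>j\<in>UNIV. (?w j * ?A j i) * u $ j * v $ i)"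
    by (intro sum.cong refl arg_cong2[where f = times] entries)
  also have "\<dots> = (\<Sum>j\<in>UNIV. \<Sum>i\<in>UNIV. (?w j * ?A j i) * u $ j * v $ i)"
    by (rule sum.swap)
  also have "\<dots> = eps_form \<epsilon> k u (embed_mat A *v v)"
    unfolding eps_form_weighted_sum matrix_vector_mult_def embed_mat_def scaleR_conv_of_real
      vec_lambda_beta nth_map_matrix sum_distrib_left
    by (intro sum.cong refl) (simp only: ac_simps)
  finally show ?thesis .
qed

section \<open>Inverse and resolvent\<close>

lemma matrix_inv_inverse:
  fixes M :: "'a::field ^ 'n ^ 'n"
  assumes "invertible M"
  shows "M ** matrix_inv M = mat 1" and "matrix_inv M ** M = mat 1"
  using someI_ex[OF assms[unfolded invertible_def]] by (auto simp: matrix_inv_def)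

text \<open>This is A S_z = z S_z - I, a rearrangement of (z I - A) S_z = I. It lets A be eliminated
  wherever it meets the resolvent.\<close>

lemma resolvent_mult:
  assumes "\<not> is_eigenvalue (embed_mat A) z"
  shows "embed_mat A *v (resolvent A z *v v) = z *s (resolvent A z *v v) - v"
proof -
  let ?M = "mat z - embed_mat A"
  have M: "?M *v u = z *s u - embed_mat A *v u" for u
    by (simp add: matrix_vector_mult_diff_rdistrib mat_mult_vec)
  \<comment> \<open>A nonzero kernel vector of z I - A would be an eigenvector for z; a square
    matrix with trivial kernel is invertible.\<close>
  have "\<forall>u. ?M *v u = 0 \<longrightarrow> u = 0"
    using assms unfolding M is_eigenvalue_def by auto
  then have "invertible ?M"
    by (simp add: invertible_left_inverse matrix_left_invertible_ker)
  then have "?M *v (resolvent A z *v v) = v"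
    by (simp add: resolvent_def matrix_inv_inverse matrix_vector_mul_assoc)
  then show ?thesis
    unfolding M by (simp add: algebra_simps)
qed

text \<open>Apply the symmetry of A to S_z u and S_z v and replace A S_z by z S_z - I on both sides:
  the terms z (S_z u, S_z v) cancel.\<close>

lemma resolvent_symmetric:
  assumes "eps_symmetric \<epsilon> k A" and "\<not> is_eigenvalue (embed_mat A) z"
  shows "eps_form \<epsilon> k (resolvent A z *v u) v = eps_form \<epsilon> k u (resolvent A z *v v)"
  using eps_symmetric_embed[OF assms(1), of "resolvent A z *v u" "resolvent A z *v v"]
  by (simp add: resolvent_mult[OF assms(2)] eps_form_diff_left eps_form_diff_right
      eps_form_scale_left eps_form_scale_right)

lemma eps_symmetric_matrix_inv:
  assumes "eps_symmetric \<epsilon> k A" and "invertible A"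
  shows "eps_symmetric \<epsilon> k (matrix_inv A)"
proof -
  have inv: "A *v (matrix_inv A *v x) = x" for x
    by (simp add: matrix_vector_mul_assoc matrix_inv_inverse[OF assms(2)])
  show ?thesis
    unfolding eps_symmetric_def
  proof (intro allI)
    fix x y
    have "eps_form \<epsilon> k (matrix_inv A *v x) (A *v (matrix_inv A *v y))
        = eps_form \<epsilon> k (A *v (matrix_inv A *v x)) (matrix_inv A *v y)"
      using assms(1) by (simp add: eps_symmetric_def)
    then show "eps_form \<epsilon> k (matrix_inv A *v x) y = eps_form \<epsilon> k x (matrix_inv A *v y)"
      by (simp add: inv)
  qed
qed

text \<open>The scalar form of \<open>z S\<^sub>z A\<^sup>-\<^sup>1 = A\<^sup>-\<^sup>1 + S\<^sub>z\<close>.\<close>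

lemma resolvent_matrix_inv:
  fixes A :: "real ^ 'n ^ 'n" and z :: "'a::real_normed_field"
  assumes "eps_symmetric \<epsilon> k A" and "invertible A" and "\<not> is_eigenvalue (embed_mat A) z"
  shows "z * eps_form \<epsilon> k (resolvent A z *v embed_vec u) (embed_vec (matrix_inv A *v v))
    = of_real (eps_form \<epsilon> k u (matrix_inv A *v v)) + eps_form \<epsilon> k (resolvent A z *v embed_vec u) (embed_vec v)"
proof -
  let ?s = "resolvent A z *v embed_vec u" and ?y = "embed_vec (matrix_inv A *v v) :: 'a ^ 'n"
  have "embed_mat A *v ?y = embed_vec v"
    by (simp add: embed_mat_vec matrix_vector_mul_assoc matrix_inv_inverse[OF assms(2)])
  \<comment> \<open>Write v as A applied to its preimage and move A across the form onto S_z u,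
    where \<open>resolvent_mult\<close> applies.\<close>
  then have "eps_form \<epsilon> k ?s (embed_vec v) = eps_form \<epsilon> k (embed_mat A *v ?s) ?y"
    by (simp add: eps_symmetric_embed[OF assms(1)])
  also have "\<dots> = z * eps_form \<epsilon> k ?s ?y - eps_form \<epsilon> k (embed_vec u) ?y"
    by (simp add: resolvent_mult[OF assms(3)] eps_form_diff_left eps_form_scale_left)
  finally show ?thesis
    by (simp add: eps_form_embed)
qed

section \<open>Differentiation along solutions\<close>

text \<open>In finite dimension bilinearity over the reals already gives boundedness. This supplies
  the product rule for the resolvent pairings of x and p.\<close>

lemma bounded_bilinear_eps_form_mult:
  fixes M :: "'a::real_normed_field ^ 'n ^ 'n"
  shows "bounded_bilinear (\<lambda>u v. eps_form \<epsilon> k (M *v embed_vec u) (embed_vec v))"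
  unfolding bilinear_conv_bounded_bilinear[symmetric] bilinear_def
  by (auto intro!: linearI simp: embed_vec_add embed_vec_scaleR matrix_vector_right_distrib
      mult_scaleR_vec eps_form_add_left eps_form_add_right eps_form_scaleR_left eps_form_scaleR_right)

lemma bounded_bilinear_eps_form_matrix:
  fixes B :: "real ^ 'n ^ 'n"
  shows "bounded_bilinear (\<lambda>u v. eps_form \<epsilon> k u (B *v v))"
  unfolding bilinear_conv_bounded_bilinear[symmetric] bilinear_def
  by (auto intro!: linearI simp: matrix_vector_right_distrib
      mult_scaleR_vec eps_form_add_left eps_form_add_right eps_form_scaleR_left eps_form_scaleR_right)

lemma is_interval_constant:
  fixes f :: "real \<Rightarrow> 'b::real_normed_vector"
  assumes "is_interval T" and "\<And>t. t \<in> T \<Longrightarrow> (f has_vector_derivative 0) (at t within T)"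
    and "s \<in> T" and "t \<in> T"
  shows "f s = f t"
  using has_vector_derivative_zero_constant[of T f] assms by (metis is_interval_convex_1)

text \<open>Of the three constraints, (p, B x) = 0 comes first, with B the inverse of A: the
  derivatives of (x, B x) and (p, p) are multiples of (p, B x), so the other two follow from
  it.\<close>

lemma geodesic_set_invariant:
  fixes A :: "real ^ 'n ^ 'n"
  assumes A: "invertible A" "eps_symmetric \<epsilon> k A"
    and T: "is_interval T" "t0 \<in> T"
    and sol: "geodesic_solution \<epsilon> k A T x p"
    and nz: "\<And>t. t \<in> T \<Longrightarrow> eps_normsq \<epsilon> k (matrix_inv A *v x t) \<noteq> 0"
    and init: "(x t0, p t0) \<in> geodesic_set \<epsilon> k A"
    and t: "t \<in> T"
  shows "(x t, p t) \<in> geodesic_set \<epsilon> k A"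
proof -
  let ?B = "matrix_inv A"
  let ?f = "\<lambda>t. eps_form \<epsilon> k (x t) (?B *v x t)"
  let ?g = "\<lambda>t. eps_form \<epsilon> k (p t) (?B *v x t)"
  let ?h = "\<lambda>t. eps_form \<epsilon> k (p t) (p t)"
  define c where "c t = eps_form \<epsilon> k (p t) (?B *v p t) / eps_normsq \<epsilon> k (?B *v x t)" for t
  have dx: "(x has_vector_derivative p t) (at t within T)"
    and dp: "(p has_vector_derivative - c t *\<^sub>R (?B *v x t)) (at t within T)" if "t \<in> T" for t
    using sol that by (auto simp: geodesic_solution_def c_def)
  have sym: "eps_form \<epsilon> k u (?B *v v) = eps_form \<epsilon> k v (?B *v u)" for u v
    using eps_symmetric_matrix_inv[OF A(2,1)]
    by (metis eps_symmetric_def eps_form_commute)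
  \<comment> \<open>The matrix is kept general: \<open>?B\<close> serves the first two constraints,
    the identity serves (p, p).\<close>
  have form: "((\<lambda>t. eps_form \<epsilon> k (u t) (M *v v t)) has_vector_derivative
      eps_form \<epsilon> k (u t) (M *v v') + eps_form \<epsilon> k u' (M *v v t)) (at t within T)"
    if "(u has_vector_derivative u') (at t within T)" and "(v has_vector_derivative v') (at t within T)"
    for u v u' v' t and M :: "real ^ 'n ^ 'n"
    using bounded_bilinear.has_vector_derivative[OF bounded_bilinear_eps_form_matrix that] .
  \<comment> \<open>The derivative is (p, B p) - c (B x, B x). The factor c is the quotient that
    makes it vanish, its denominator being nonzero by \<open>nz\<close>.\<close>
  have "(?g has_vector_derivative 0) (at t within T)" if "t \<in> T" for t
    using form[where M = ?B, OF dp dx, OF that that] nz[OF that]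
    by (simp add: eps_form_scaleR_left c_def eps_normsq_def flip: scaleR_minus_left)
  then have g: "?g t = 0" if "t \<in> T" for t
    using is_interval_constant[OF T(1) _ T(2) that, of ?g] init by (simp add: geodesic_set_def)
  \<comment> \<open>By symmetry of B both terms of the product rule equal (p, B x), which is
    zero.\<close>
  have "(?f has_vector_derivative 0) (at t within T)" if "t \<in> T" for t
    using form[where M = ?B, OF dx dx, OF that that] g[OF that]
    by (simp add: sym[of "x t"])
  then have f: "?f t = 1"
    using is_interval_constant[OF T(1) _ T(2) t, of ?f] init by (simp add: geodesic_set_def)
  \<comment> \<open>The acceleration is a multiple of B x, to which p is orthogonal.\<close>
  have "(?h has_vector_derivative 0) (at t within T)" if "t \<in> T" for t
    using form[where M = "mat 1", OF dp dp, OF that that] g[OF that]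
    by (simp add: eps_form_scaleR_left eps_form_scaleR_right eps_form_commute[of _ _ "?B *v x t"]
        flip: scaleR_minus_left)
  then have "?h t = 1"
    using is_interval_constant[OF T(1) _ T(2) t, of ?h] init
    by (simp add: geodesic_set_def eps_normsq_def)
  with f g[OF t] show ?thesis
    by (simp add: geodesic_set_def eps_normsq_def)
qed

text \<open>The derivative argument cancels a factor z, so z = 0 is treated apart: there the
  resolvent identity directly kills both 1 + a and b, hence both terms of G.\<close>

lemma geodesic_G_at_zero:
  assumes "invertible A" and "eps_symmetric \<epsilon> k A"
    and "\<not> is_eigenvalue (embed_mat A) (0 :: 'a::real_normed_field)"
    and "(x, p) \<in> geodesic_set \<epsilon> k A"
  shows "geodesic_G \<epsilon> k A (0 :: 'a) x p = 0"
proof -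
  let ?S = "\<lambda>u v. eps_form \<epsilon> k (resolvent A (0 :: 'a) *v embed_vec u) (embed_vec v)"
  have id: "of_real (eps_form \<epsilon> k u (matrix_inv A *v v)) + ?S u v = 0" for u v
    using resolvent_matrix_inv[OF assms(2,1,3), of u v] by simp
  have "1 + ?S x x = 0" and "?S p x = 0"
    using id[of x x] id[of p x] assms(4) by (simp_all add: geodesic_set_def)
  moreover have "?S x p = ?S p x"
    using resolvent_symmetric[OF assms(2,3)] eps_form_commute by metis
  ultimately show ?thesis
    by (simp add: geodesic_G_def)
qed

theorem corollary3:
  fixes \<epsilon> :: real and k :: "'n::finite" and A :: "real ^ 'n ^ 'n"
    and z :: "'a::real_normed_field"
    and T :: "real set" and t0 :: real
    and x p :: "real \<Rightarrow> real ^ 'n"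
  assumes "\<epsilon> \<in> {1, -1}"
    and "invertible A" and "eps_symmetric \<epsilon> k A" and "eps_positive \<epsilon> k A"
    and "\<not> is_eigenvalue (embed_mat A) z"
    and "is_interval T" and "t0 \<in> T"
    and "geodesic_solution \<epsilon> k A T x p"
    and "\<And>t. t \<in> T \<Longrightarrow> eps_normsq \<epsilon> k (matrix_inv A *v x t) \<noteq> 0"
    and "(x t0, p t0) \<in> geodesic_set \<epsilon> k A"
  shows "\<forall>t\<in>T. (x t, p t) \<in> geodesic_set \<epsilon> k A \<and>
           geodesic_G \<epsilon> k A z (x t) (p t) = geodesic_G \<epsilon> k A z (x t0) (p t0)"
proof -
  note A = \<open>invertible A\<close> \<open>eps_symmetric \<epsilon> k A\<close> and z = \<open>\<not> is_eigenvalue (embed_mat A) z\<close>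
  have set: "(x t, p t) \<in> geodesic_set \<epsilon> k A" if "t \<in> T" for t
    using geodesic_set_invariant[OF A assms(6-10) that] .
  have "geodesic_G \<epsilon> k A z (x t) (p t) = geodesic_G \<epsilon> k A z (x t0) (p t0)" if "t \<in> T" for t
  proof (cases "z = 0")
    case True
    then show ?thesis
      using geodesic_G_at_zero[OF A] z set \<open>t \<in> T\<close> \<open>t0 \<in> T\<close> by metis
  next
    case False
    let ?B = "matrix_inv A"
    define c where "c t = eps_form \<epsilon> k (p t) (?B *v p t) / eps_normsq \<epsilon> k (?B *v x t)" for t
    define S where "S u v = eps_form \<epsilon> k (resolvent A z *v embed_vec u) (embed_vec v)" for u v
    interpret S: bounded_bilinear S
      unfolding S_def by (rule bounded_bilinear_eps_form_mult)
    have sym: "S u v = S v u" for u v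
      unfolding S_def using resolvent_symmetric[OF A(2) z] eps_form_commute by metis
    have "((\<lambda>t. geodesic_G \<epsilon> k A z (x t) (p t)) has_vector_derivative 0) (at t within T)"
      if "t \<in> T" for t
    proof -
      let ?C = "of_real (c t) :: 'a"
      have dx: "(x has_vector_derivative p t) (at t within T)"
        and dp: "(p has_vector_derivative - c t *\<^sub>R (?B *v x t)) (at t within T)"
        using assms(8) that by (auto simp: geodesic_solution_def c_def)
      \<comment> \<open>The resolvent identity with the constraints (x, B x) = 1 and (p, B x) = 0
        inserted.\<close>
      have xB: "z * S (x t) (?B *v x t) = 1 + S (x t) (x t)"
        and pB: "z * S (p t) (?B *v x t) = S (x t) (p t)"
        using resolvent_matrix_inv[OF A(2,1) z, of "x t" "x t"]
          resolvent_matrix_inv[OF A(2,1) z, of "p t" "x t"] set[OF that] sym[of "x t" "p t"]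
        by (simp_all add: geodesic_set_def S_def)
      have da: "((\<lambda>t. S (x t) (x t)) has_vector_derivative 2 * S (x t) (p t)) (at t within T)"
        using S.has_vector_derivative[OF dx dx] by (simp add: sym[of "p t" "x t"])
      have db: "((\<lambda>t. S (x t) (p t)) has_vector_derivative
          S (p t) (p t) - ?C * S (x t) (?B *v x t)) (at t within T)"
        using S.has_vector_derivative[OF dx dp]
        by (simp add: S.scaleR_right S.minus_right flip: scaleR_conv_of_real)
      have dd: "((\<lambda>t. S (p t) (p t)) has_vector_derivative
          - 2 * ?C * S (p t) (?B *v x t)) (at t within T)"
        using S.has_vector_derivative[OF dp dp]
        by (simp add: S.scaleR_right S.scaleR_left S.minus_right S.minus_left sym[of "?B *v x t"])
          (simp add: scaleR_conv_of_real mult.left_commute mult.assoc)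
      \<comment> \<open>The product rule for (1 + a) d - b^2, with the derivatives
        \<open>da\<close>, \<open>db\<close> and \<open>dd\<close> inserted.\<close>
      let ?D = "(1 + S (x t) (x t)) * (- 2 * ?C * S (p t) (?B *v x t))
          + 2 * S (x t) (p t) * S (p t) (p t)
          - 2 * S (x t) (p t) * (S (p t) (p t) - ?C * S (x t) (?B *v x t))"
      \<comment> \<open>The two terms 2 b d cancel. The factor z is placed next to the pairings with
        B x, so that \<open>xB\<close> and \<open>pB\<close> turn what remains into two opposite
        multiples of (1 + a) b.\<close>
      have "z * ?D = - 2 * ?C * (1 + S (x t) (x t)) * (z * S (p t) (?B *v x t))
          + 2 * ?C * S (x t) (p t) * (z * S (x t) (?B *v x t))"
        by (simp add: algebra_simps)
      also have "\<dots> = 0"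
        unfolding xB pB by (simp add: algebra_simps)
      finally have "?D = 0"
        using False by simp
      moreover have "((\<lambda>t. (1 + S (x t) (x t)) * S (p t) (p t) - S (x t) (p t) * S (x t) (p t))
          has_vector_derivative ?D) (at t within T)"
        by (rule derivative_eq_intros da db dd refl)+ (simp add: algebra_simps)
      ultimately show ?thesis
        by (simp add: geodesic_G_def S_def power2_eq_square)
    qed
    from is_interval_constant[OF assms(6) this \<open>t \<in> T\<close> \<open>t0 \<in> T\<close>] show ?thesis .
  qed
  with set show ?thesis by blast
qed

end
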